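(* There exists an infinite family of connected $3$-valent $2$-arc-transitive graphs $\{\Lambda_n\}_{n\in\mathbb{N}}$ such that the $1$-eigenspace of $\Lambda_n$ over $\mathbb{F}_2$ has dimension at least $|\mathrm{V}(\Lambda_n)|/72$.
   Context: Graphs are finite, simple and undirected. A $2$-arc of a graph is a sequence $(u,v,w)$ of vertices with $u\sim v\sim w$ and $u\ne w$; a graph is $2$-arc-transitive if its automorphism group acts transitively on its $2$-arcs. The $1$-eigenspace of a graph $\Lambda$ over $\mathbb{F}_2$ is the eigenspace for eigenvalue $1$ of its adjacency matrix regarded as a matrix over the field $\mathbb{F}_2$ of order $2$, i.e. the set of $x\in\mathbb{F}_2^{\mathrm{V}(\Lambda)}$ with $\sum_{u\sim v}x(u)=x(v)$ for every vertex $v$. *)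

theory Defs
  imports
    Complex_Main
    "HOL-Library.Z2"
    "HOL-Library.Function_Algebras"
    "HOL-Combinatorics.Permutations"
    "Graph_Theory.Pair_Digraph"
    "Graph_Theory.Digraph_Component"
    "Graph_Theory.Digraph_Isomorphism"
begin

text \<open>A finite simple undirected graph is a \<open>pair_graph\<close>: each edge is stored
  as the two arcs \<open>(u, v)\<close> and \<open>(v, u)\<close>, so the out-degree is the valency.\<close>

definition automorphisms :: "'a pair_pre_digraph \<Rightarrow> ('a \<Rightarrow> 'a) set" where
  "automorphisms G = {f. f permutes pverts G \<and>
     (\<forall>u\<in>pverts G. \<forall>v\<in>pverts G. (f u, f v) \<in> parcs G \<longleftrightarrow> (u, v) \<in> parcs G)}"

definition two_arcs :: "'a pair_pre_digraph \<Rightarrow> ('a \<times> 'a \<times> 'a) set" where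
  "two_arcs G = {(u, v, w). (u, v) \<in> parcs G \<and> (v, w) \<in> parcs G \<and> u \<noteq> w}"

definition two_arc_transitive :: "'a pair_pre_digraph \<Rightarrow> bool" where
  "two_arc_transitive G \<longleftrightarrow>
     (\<forall>(u, v, w) \<in> two_arcs G. \<forall>(u', v', w') \<in> two_arcs G.
        \<exists>f \<in> automorphisms G. (f u, f v, f w) = (u', v', w'))"

definition valent :: "nat \<Rightarrow> 'a pair_pre_digraph \<Rightarrow> bool" where
  "valent k G \<longleftrightarrow> (\<forall>v\<in>pverts G. out_degree (with_proj G) v = k)"

definition adjacency :: "'a pair_pre_digraph \<Rightarrow> 'a \<Rightarrow> 'a \<Rightarrow> 'k::field" where
  "adjacency G v u = (if (v, u) \<in> parcs G then 1 else 0)"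

text \<open>A vector indexed by the vertex set is a function vanishing off the vertices.\<close>

definition eigenspace :: "'a pair_pre_digraph \<Rightarrow> 'k::field \<Rightarrow> ('a \<Rightarrow> 'k) set" where
  "eigenspace G c = {x. (\<forall>v. v \<notin> pverts G \<longrightarrow> x v = 0) \<and>
     (\<forall>v\<in>pverts G. (\<Sum>u\<in>pverts G. adjacency G v u * x u) = c * x v)}"

definition fscale :: "'k::field \<Rightarrow> ('a \<Rightarrow> 'k) \<Rightarrow> 'a \<Rightarrow> 'k" where
  "fscale c x = (\<lambda>v. c * x v)"

global_interpretation fun_space: vector_space "fscale :: 'k::field \<Rightarrow> ('a \<Rightarrow> 'k) \<Rightarrow> 'a \<Rightarrow> 'k"
  by unfold_locales (auto simp: fscale_def fun_eq_iff algebra_simps)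

lemma subspace_eigenspace: "fun_space.subspace (eigenspace G c)"
  by (auto simp: fun_space.subspace_def eigenspace_def fscale_def algebra_simps sum.distrib
      simp flip: sum_distrib_left)

lemma eigenspace_one_F2:
  assumes "pair_graph G"
  shows "eigenspace G (1::bit) = {x. (\<forall>v. v \<notin> pverts G \<longrightarrow> x v = 0) \<and>
     (\<forall>v\<in>pverts G. (\<Sum>u | (u, v) \<in> parcs G. x u) = x v)}"
proof -
  interpret pair_graph G by fact
  have "(\<Sum>u\<in>pverts G. adjacency G v u * x u) = (\<Sum>u | (u, v) \<in> parcs G. x u)"
    for v and x :: "'a \<Rightarrow> bit"
  proof -
    have "{u. (u, v) \<in> parcs G} = {u \<in> pverts G. (v, u) \<in> parcs G}"
      using graph_symmetric in_arcsD1 by fastforce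
    then have "(\<Sum>u | (u, v) \<in> parcs G. x u) = (\<Sum>u\<in>pverts G. if (v, u) \<in> parcs G then x u else 0)"
      by (simp only: sum.inter_filter [OF pair_finite_verts])
    also have "\<dots> = (\<Sum>u\<in>pverts G. adjacency G v u * x u)"
      by (rule sum.cong) (simp_all add: adjacency_def)
    finally show ?thesis ..
  qed
  then show ?thesis by (simp only: eigenspace_def mult_1_left)
qed

end

theory Submission
  imports Defs "HOL-Library.Countable"
begin

text \<open>
  If a vertex-transitive graph has a nonzero eigenvector with at most \<open>k\<close> nonzero entries, then its
  eigenspace has dimension at least \<open>|V|/k\<close>: a basis chosen among the images of that vector under
  automorphisms has supports covering all vertices. Hence it suffices to find infinitely many
  connected cubic 2-arc-transitive graphs with a \<open>1\<close>-eigenvector over \<open>F\<^sub>2\<close> supported on 72 vertices.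

  The Moebius-Kantor graph has an automorphism \<open>z\<close> of order 2 with quotient the cube. The part of its
  first homology that \<open>z\<close> inverts has rank 4, so it gives a regular cover with group \<open>\<int>\<^sup>4\<close> to which all
  automorphisms lift. This infinite cover has a finitely supported eigenvector with 72 nonzero
  entries, which survives in the finite quotients with covering group \<open>(\<int>/n)\<^sup>4\<close>.
\<close>

section \<open>Sparse eigenvectors of vertex-transitive graphs\<close>

text \<open>A maximal independent \<open>B\<close> inside \<open>X\<close> spans all of
  \<open>X\<close>, so every vector of \<open>X\<close> vanishes off the union of the supports of
  \<open>B\<close>, which has at most \<open>k * card B\<close> points.\<close>

lemma card_le_mult_dim_if_sparse_cover:
  fixes W :: "('a \<Rightarrow> 'k::field) set"
  assumes "finite W" and "X \<subseteq> W"
    and fin: "\<And>x. x \<in> X \<Longrightarrow> finite {v. x v \<noteq> 0}"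
    and sparse: "\<And>x. x \<in> X \<Longrightarrow> card {v. x v \<noteq> 0} \<le> k"
    and cover: "V \<subseteq> (\<Union>x\<in>X. {v. x v \<noteq> 0})"
  shows "card V \<le> k * fun_space.dim W"
proof -
  obtain B where B: "B \<subseteq> X" "fun_space.independent B" "X \<subseteq> fun_space.span B"
    using fun_space.maximal_independent_subset by metis
  from B(1) \<open>X \<subseteq> W\<close> have "B \<subseteq> W" by blast
  \<comment> \<open>The dimension of \<open>W\<close> is read off from a basis, so \<open>B\<close>
    is extended to one inside \<open>W\<close>.\<close>
  then obtain C where C: "B \<subseteq> C" "C \<subseteq> W" "fun_space.independent C" "W \<subseteq> fun_space.span C"
    using fun_space.maximal_independent_subset_extend[of B W] B(2) by metis
  have finB: "finite B" and finC: "finite C"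
    using \<open>finite W\<close> \<open>B \<subseteq> W\<close> C(2) by (auto intro: finite_subset)
  define U where "U = (\<Union>b\<in>B. {v. b v \<noteq> 0})"
  have "fun_space.subspace {x :: 'a \<Rightarrow> 'k. \<forall>v. v \<notin> U \<longrightarrow> x v = 0}"
    by (auto simp: fun_space.subspace_def fscale_def)
  moreover have "B \<subseteq> {x. \<forall>v. v \<notin> U \<longrightarrow> x v = 0}"
    by (auto simp: U_def)
  ultimately have "fun_space.span B \<subseteq> {x. \<forall>v. v \<notin> U \<longrightarrow> x v = 0}"
    by (rule fun_space.span_minimal[rotated])
  with B(3) cover have "V \<subseteq> U" by blast
  moreover have "finite U"
    unfolding U_def using finB fin B(1) by auto
  ultimately have "card V \<le> card U" by (rule card_mono[rotated])
  also have "\<dots> \<le> (\<Sum>b\<in>B. card {v. b v \<noteq> 0})"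
    unfolding U_def using finB by (rule card_UN_le)
  also have "\<dots> \<le> k * card B"
    using sum_bounded_above[of B "\<lambda>b. card {v. b v \<noteq> 0}" k] sparse B(1)
    by (auto simp: mult.commute)
  also have "\<dots> \<le> k * card C"
    using card_mono[OF finC C(1)] by simp
  also have "card C = fun_space.dim W"
    using C(2,4,3) by (rule fun_space.basis_card_eq_dim)
  finally show ?thesis .
qed

text \<open>Over a finite field the eigenspace is a finite set, so its independent subsets are
  finite and can be compared by cardinality.\<close>

lemma finite_eigenspace_bit:
  assumes "finite (pverts G)"
  shows "finite (eigenspace G (c :: bit))"
proof (rule finite_subset)
  have "(UNIV :: bit set) = {0, 1}"
    by auto
  then have "finite (UNIV :: bit set)"
    by (metis finite.emptyI finite_insert)
  then show "finite {x :: 'a \<Rightarrow> bit. \<forall>v. (v \<in> pverts G \<longrightarrow> x v \<in> UNIV) \<and> (v \<notin> pverts G \<longrightarrow> x v = 0)}"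
    using assms by (rule finite_set_of_finite_funs[rotated])
qed (auto simp: eigenspace_def)

lemma eigenspace_comp_automorphism:
  assumes f: "f \<in> automorphisms G" and x: "x \<in> eigenspace G c"
  shows "x \<circ> f \<in> eigenspace G c"
proof -
  have perm: "f permutes pverts G"
    and adj: "\<And>u v. u \<in> pverts G \<Longrightarrow> v \<in> pverts G \<Longrightarrow> (f u, f v) \<in> parcs G \<longleftrightarrow> (u, v) \<in> parcs G"
    using f by (auto simp: automorphisms_def)
  have "(\<Sum>u\<in>pverts G. adjacency G v u * x (f u)) = c * x (f v)" if v: "v \<in> pverts G" for v
  proof -
    have "(\<Sum>u\<in>pverts G. adjacency G v u * x (f u)) = (\<Sum>u\<in>pverts G. adjacency G (f v) (f u) * x (f u))"
      using adj v by (intro sum.cong) (auto simp: adjacency_def)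
    also have "\<dots> = (\<Sum>u\<in>pverts G. adjacency G (f v) u * x u)"
      using sum.permute[OF perm, of "\<lambda>u. adjacency G (f v) u * x u"] by (simp add: comp_def)
    also have "\<dots> = c * x (f v)"
      using x v perm by (auto simp: eigenspace_def permutes_in_image)
    finally show ?thesis .
  qed
  moreover have "x (f v) = 0" if "v \<notin> pverts G" for v
    using x that perm by (auto simp: eigenspace_def permutes_not_in)
  ultimately show ?thesis
    by (auto simp: eigenspace_def)
qed

lemma card_verts_le_mult_dim_eigenspace:
  fixes x :: "'a \<Rightarrow> bit"
  assumes fin: "finite (pverts G)"
    and trans: "\<And>u v. u \<in> pverts G \<Longrightarrow> v \<in> pverts G \<Longrightarrow> \<exists>f\<in>automorphisms G. f u = v"
    and x: "x \<in> eigenspace G c" and w: "x w \<noteq> 0" and sparse: "card {v. x v \<noteq> 0} \<le> k"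
  shows "card (pverts G) \<le> k * fun_space.dim (eigenspace G c)"
proof (rule card_le_mult_dim_if_sparse_cover)
  let ?X = "(\<lambda>f. x \<circ> f) ` automorphisms G"
  show "finite (eigenspace G c)"
    using fin by (rule finite_eigenspace_bit)
  show "?X \<subseteq> eigenspace G c"
    using x by (auto intro: eigenspace_comp_automorphism)
  have supp: "{v. x v \<noteq> 0} \<subseteq> pverts G"
    using x by (auto simp: eigenspace_def)
  have vimage: "finite {v. y v \<noteq> 0} \<and> card {v. y v \<noteq> 0} \<le> k" if "y \<in> ?X" for y
  proof -
    from that obtain f where f: "f \<in> automorphisms G" and y: "y = x \<circ> f" by blast
    from f have bij: "inj f" "surj f"
      by (auto simp: automorphisms_def permutes_inj permutes_surj)
    have eq: "{v. y v \<noteq> 0} = f -` {v. x v \<noteq> 0}"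
      by (auto simp: y)
    have "finite {v. x v \<noteq> 0}"
      using supp fin by (rule finite_subset)
    then have "finite (f -` {v. x v \<noteq> 0})"
      using bij(1) by (rule finite_vimageI)
    moreover have "card (f -` {v. x v \<noteq> 0}) \<le> k"
      using card_vimage_inj[OF bij(1), of "{v. x v \<noteq> 0}"] bij(2) sparse by simp
    ultimately show ?thesis
      unfolding eq ..
  qed
  show "finite {v. y v \<noteq> 0}" "card {v. y v \<noteq> 0} \<le> k" if "y \<in> ?X" for y
    using vimage[OF that] by auto
  show "pverts G \<subseteq> (\<Union>y\<in>?X. {v. y v \<noteq> 0})"
  proof
    fix v assume "v \<in> pverts G"
    moreover have "w \<in> pverts G" using supp w by auto
    \<comment> \<open>Composing \<open>x\<close> with an automorphism that takes \<open>v\<close> to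
      \<open>w\<close> gives a vector that is nonzero at \<open>v\<close>.\<close>
    ultimately obtain f where "f \<in> automorphisms G" "f v = w" using trans by blast
    with w show "v \<in> (\<Union>y\<in>?X. {v. y v \<noteq> 0})" by force
  qed
qed

section \<open>Automorphisms and relabelling\<close>

text \<open>An injection that preserves arcs permutes the finite set of arcs, so it reflects them as
  well.\<close>

lemma automorphismsI:
  assumes "finite (pverts G)" "parcs G \<subseteq> pverts G \<times> pverts G"
    and into: "f ` pverts G \<subseteq> pverts G" and inj: "inj_on f (pverts G)"
    and id: "\<And>v. v \<notin> pverts G \<Longrightarrow> f v = v"
    and arcs: "\<And>u v. (u, v) \<in> parcs G \<Longrightarrow> (f u, f v) \<in> parcs G"
  shows "f \<in> automorphisms G"
proof -
  have "f ` pverts G = pverts G"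
    using assms(1) into inj by (rule endo_inj_surj)
  then have perm: "f permutes pverts G"
    using inj id by (intro bij_imp_permutes) (auto simp: bij_betw_def)
  then have injf: "inj (map_prod f f)"
    by (intro prod.inj_map) (auto simp: permutes_inj)
  have "finite (parcs G)"
    using assms(1,2) by (meson finite_SigmaI finite_subset)
  moreover have "map_prod f f ` parcs G \<subseteq> parcs G"
    using arcs by auto
  ultimately have surj: "map_prod f f ` parcs G = parcs G"
    using injf by (intro endo_inj_surj) (auto intro: inj_on_subset)
  have "(u, v) \<in> parcs G" if "(f u, f v) \<in> parcs G" for u v
  proof -
    from that surj have "map_prod f f (u, v) \<in> map_prod f f ` parcs G" by simp
    with injf show ?thesis by (simp only: inj_image_mem_iff)
  qed
  with perm arcs show ?thesis
    unfolding automorphisms_def by blast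
qed

lemma automorphisms_comp:
  assumes "f \<in> automorphisms G" "g \<in> automorphisms G"
  shows "f \<circ> g \<in> automorphisms G"
  using assms by (auto simp: automorphisms_def permutes_compose permutes_in_image)

lemma automorphisms_inv:
  assumes "f \<in> automorphisms G"
  shows "inv f \<in> automorphisms G"
proof -
  have perm: "f permutes pverts G"
    using assms by (simp add: automorphisms_def)
  have "(inv f u, inv f v) \<in> parcs G \<longleftrightarrow> (u, v) \<in> parcs G" if "u \<in> pverts G" "v \<in> pverts G" for u v
  proof -
    have "inv f u \<in> pverts G" "inv f v \<in> pverts G"
      using that permutes_in_image[OF permutes_inv[OF perm]] by simp_all
    then have "(f (inv f u), f (inv f v)) \<in> parcs G \<longleftrightarrow> (inv f u, inv f v) \<in> parcs G"
      using assms by (simp add: automorphisms_def)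
    then show ?thesis
      by (simp add: permutes_inverses(1)[OF perm])
  qed
  with permutes_inv[OF perm] show ?thesis
    by (simp add: automorphisms_def)
qed

lemma id_automorphism: "id \<in> automorphisms G"
  by (simp add: automorphisms_def permutes_id)

lemma two_arcs_automorphism:
  assumes "f \<in> automorphisms G" "parcs G \<subseteq> pverts G \<times> pverts G" "(u, v, w) \<in> two_arcs G"
  shows "(f u, f v, f w) \<in> two_arcs G"
proof -
  have "inj f" using assms(1) by (auto simp: automorphisms_def permutes_inj)
  with assms show ?thesis
    by (auto simp: automorphisms_def two_arcs_def inj_eq)
qed

section \<open>Transport of graphs along an injection of the vertices\<close>

definition relabel :: "('a \<Rightarrow> 'b) \<Rightarrow> 'a pair_pre_digraph \<Rightarrow> 'b pair_pre_digraph" where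
  "relabel e G = \<lparr>pverts = e ` pverts G, parcs = map_prod e e ` parcs G\<rparr>"

text \<open>Through this isomorphism record connectedness and degrees are transferred. Relabelling
  serves to pass from covers on pairs to graphs on natural numbers.\<close>

definition relabel_iso :: "('a \<Rightarrow> 'b) \<Rightarrow> ('a, 'a \<times> 'a, 'b, 'b \<times> 'b) digraph_isomorphism" where
  "relabel_iso e = \<lparr>iso_verts = e, iso_arcs = map_prod e e, iso_head = snd, iso_tail = fst\<rparr>"

lemma pverts_relabel [simp]: "pverts (relabel e G) = e ` pverts G"
  and parcs_relabel: "parcs (relabel e G) = map_prod e e ` parcs G"
  by (simp_all add: relabel_def)

lemma with_proj_relabel: "with_proj (relabel e G) = app_iso (relabel_iso e) (with_proj G)"
  by (simp add: relabel_def relabel_iso_def app_iso_def with_proj_def)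

lemma arc_relabel_iff:
  assumes "inj e"
  shows "(e u, e v) \<in> parcs (relabel e G) \<longleftrightarrow> (u, v) \<in> parcs G"
  using assms by (auto simp: parcs_relabel inj_eq)

context
  fixes e :: "'a \<Rightarrow> 'b" and G :: "'a pair_pre_digraph"
  assumes e: "inj e" and G: "pair_graph G"
begin

interpretation pair_graph G by (fact G)

lemma digraph_isomorphism_relabel: "digraph_isomorphism (relabel_iso e)"
  using e unfolding digraph_isomorphism_def relabel_iso_def
  by (auto simp: inj_on_def wf_digraph_axioms)

lemma pair_graph_relabel: "pair_graph (relabel e G)"
proof
  show "finite (pverts (relabel e G))" "finite (parcs (relabel e G))"
    by (simp_all add: parcs_relabel)
  show "symmetric (with_proj (relabel e G))"
    using pair_sym_arcs by (auto simp: parcs_relabel symmetric_def intro!: symI dest: symD)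
next
  fix a assume "a \<in> parcs (relabel e G)"
  then obtain u v where "a = (e u, e v)" "(u, v) \<in> parcs G"
    by (auto simp: parcs_relabel)
  then show "fst a \<in> pverts (relabel e G)" "snd a \<in> pverts (relabel e G)" "fst a \<noteq> snd a"
    using e pair_no_loops[of "(u, v)"] by (auto simp: inj_eq dest: in_arcsD1 in_arcsD2)
qed

lemma connected_relabel:
  assumes "Digraph_Component.connected (with_proj G)"
  shows "Digraph_Component.connected (with_proj (relabel e G))"
  unfolding with_proj_relabel using assms digraph_isomorphism_relabel by (rule connectedI_app_iso)

lemma valent_relabel:
  assumes "valent k G"
  shows "valent k (relabel e G)"
  using assms out_degree_app_iso_eq[OF digraph_isomorphism_relabel]
  by (auto simp: valent_def with_proj_relabel relabel_iso_def)

lemma automorphism_relabel: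
  assumes f: "f \<in> automorphisms G"
  obtains g where "g \<in> automorphisms (relabel e G)" "\<And>v. v \<in> pverts G \<Longrightarrow> g (e v) = e (f v)"
proof
  \<comment> \<open>The conjugate of \<open>f\<close> by \<open>e\<close>; it is the identity off
    the image because an automorphism fixes every non-vertex.\<close>
  let ?g = "\<lambda>v. if v \<in> e ` pverts G then e (f (inv_into (pverts G) e v)) else v"
  have perm: "f permutes pverts G" using f by (simp add: automorphisms_def)
  have "inj_on e (pverts G)" using e by (rule inj_on_subset) simp
  then have g: "?g (e v) = e (f v)" if "v \<in> pverts G" for v
    using that by simp
  then show "\<And>v. v \<in> pverts G \<Longrightarrow> ?g (e v) = e (f v)" .
  have "?g permutes e ` pverts G"
    using perm \<open>inj_on e (pverts G)\<close> by (intro permutes_bij_inv_into) (auto simp: bij_betw_def)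
  moreover have "(?g (e u), ?g (e v)) \<in> parcs (relabel e G) \<longleftrightarrow> (e u, e v) \<in> parcs (relabel e G)"
    if "u \<in> pverts G" "v \<in> pverts G" for u v
    using f that unfolding g[OF that(1)] g[OF that(2)] arc_relabel_iff[OF e]
    by (simp add: automorphisms_def)
  ultimately show "?g \<in> automorphisms (relabel e G)"
    unfolding automorphisms_def pverts_relabel by blast
qed

lemma two_arcs_relabel: "two_arcs (relabel e G) = (\<lambda>(u, v, w). (e u, e v, e w)) ` two_arcs G"
proof -
  have "t \<in> (\<lambda>(u, v, w). (e u, e v, e w)) ` two_arcs G" if "t \<in> two_arcs (relabel e G)" for t
  proof -
    obtain u v w where t: "t = (e u, e v, e w)"
      using \<open>t \<in> _\<close> by (auto simp: two_arcs_def parcs_relabel)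
    with that have "(u, v, w) \<in> two_arcs G"
      by (auto simp: two_arcs_def arc_relabel_iff[OF e])
    with t show ?thesis by force
  qed
  then show ?thesis
    using e by (auto simp: two_arcs_def arc_relabel_iff inj_eq)
qed

lemma two_arc_transitive_relabel:
  assumes "two_arc_transitive G"
  shows "two_arc_transitive (relabel e G)"
proof -
  have "\<exists>g\<in>automorphisms (relabel e G). (g (e u), g (e v), g (e w)) = (e u', e v', e w')"
    if t: "(u, v, w) \<in> two_arcs G" "(u', v', w') \<in> two_arcs G" for u v w u' v' w'
  proof -
    obtain f where f: "f \<in> automorphisms G" "(f u, f v, f w) = (u', v', w')"
      using assms t unfolding two_arc_transitive_def by fast
    obtain g where g: "g \<in> automorphisms (relabel e G)" "\<And>v. v \<in> pverts G \<Longrightarrow> g (e v) = e (f v)"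
      using automorphism_relabel[OF f(1)] by blast
    have "u \<in> pverts G" "v \<in> pverts G" "w \<in> pverts G"
      using t(1) by (auto simp: two_arcs_def dest: in_arcsD1 in_arcsD2)
    with f(2) g show ?thesis by auto
  qed
  then show ?thesis
    unfolding two_arc_transitive_def two_arcs_relabel by fast
qed

lemma eigenspace_relabel:
  assumes x: "x \<in> eigenspace G c"
  obtains y where "y \<in> eigenspace (relabel e G) c" "\<And>v. y (e v) = x v"
    "{v. y v \<noteq> 0} = e ` {v. x v \<noteq> 0}"
proof
  let ?y = "\<lambda>v. if v \<in> e ` pverts G then x (inv e v) else 0"
  have off: "x v = 0" if "v \<notin> pverts G" for v
    using x that by (simp add: eigenspace_def)
  show y: "?y (e v) = x v" for v
    using off[of v] e by (auto simp: inj_eq inj_image_mem_iff)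
  show "{v. ?y v \<noteq> 0} = e ` {v. x v \<noteq> 0}"
  proof (intro equalityI subsetI)
    fix v assume "v \<in> {v. ?y v \<noteq> 0}"
    then obtain u where "v = e u" "?y (e u) \<noteq> 0" by (auto split: if_splits)
    with y show "v \<in> e ` {v. x v \<noteq> 0}" by simp
  next
    fix v assume "v \<in> e ` {v. x v \<noteq> 0}"
    then obtain u where "v = e u" "x u \<noteq> 0" by blast
    with y[of u] show "v \<in> {v. ?y v \<noteq> 0}" by simp
  qed
  have "(\<Sum>u\<in>e ` pverts G. adjacency (relabel e G) (e v) u * ?y u) = c * ?y (e v)"
    if "v \<in> pverts G" for v
  proof -
    have "(\<Sum>u\<in>e ` pverts G. adjacency (relabel e G) (e v) u * ?y u) =
        (\<Sum>u\<in>pverts G. adjacency (relabel e G) (e v) (e u) * ?y (e u))"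
      using e by (subst sum.reindex) (auto intro: inj_on_subset)
    also have "\<dots> = (\<Sum>u\<in>pverts G. adjacency G v u * x u)"
      unfolding y by (simp add: adjacency_def arc_relabel_iff[OF e])
    also have "\<dots> = c * x v"
      using x that by (simp add: eigenspace_def)
    finally show ?thesis unfolding y .
  qed
  then show "?y \<in> eigenspace (relabel e G) c"
    unfolding eigenspace_def pverts_relabel by auto
qed

end

lemma card_pverts_eq_if_digraph_iso:
  assumes "digraph_iso (with_proj G) (with_proj H)"
  shows "card (pverts G) = card (pverts H)"
proof -
  obtain h where h: "pre_digraph.digraph_isomorphism (with_proj G) h"
    and H: "with_proj H = app_iso h (with_proj G)"
    using assms by (auto simp: digraph_iso_def)
  have "pverts H = iso_verts h ` pverts G"
    using H by (metis verts_app_iso with_proj_simps(1))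
  with card_verts_iso[OF h] show ?thesis by simp
qed

section \<open>Abelian covers of the Moebius-Kantor graph\<close>

text \<open>\<open>Vec p q r s\<close> stands for \<open>p + q\<zeta> + r\<zeta>\<^sup>2 + s\<zeta>\<^sup>3\<close> with \<open>\<zeta>\<^sup>4 = -1\<close>.\<close>

datatype vec = Vec int int int int

instance vec :: countable
  by countable_datatype

instantiation vec :: ab_group_add
begin

definition zero_vec :: vec where
  "0 = Vec 0 0 0 0"

fun plus_vec :: "vec \<Rightarrow> vec \<Rightarrow> vec" where
  "Vec p q r s + Vec p' q' r' s' = Vec (p + p') (q + q') (r + r') (s + s')"

fun uminus_vec :: "vec \<Rightarrow> vec" where
  "- Vec p q r s = Vec (- p) (- q) (- r) (- s)"

definition minus_vec :: "vec \<Rightarrow> vec \<Rightarrow> vec" where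
  "x - y = x + - (y :: vec)"

instance
proof
  fix x y z :: vec
  show "x + y + z = x + (y + z)" by (cases x; cases y; cases z) simp
  show "x + y = y + x" by (cases x; cases y) simp
  show "0 + x = x" by (cases x) (simp add: zero_vec_def)
  show "- x + x = 0" by (cases x) (simp add: zero_vec_def)
  show "x - y = x + - y" by (rule minus_vec_def)
qed

end

text \<open>Multiplication by \<zeta>; the sign comes from \<zeta>^4 = -1.\<close>

fun zeta :: "vec \<Rightarrow> vec" where
  "zeta (Vec p q r s) = Vec (- s) p q r"

text \<open>The Moebius-Kantor graph is the cycle \<open>0, \<dots>, 15\<close> with the chords joining \<open>2i\<close> to \<open>2i + 5\<close>.
  The voltages \<open>\<zeta>\<^sup>i\<close>, \<open>\<zeta>\<^sup>i(\<zeta>\<^sup>2 - \<zeta>)\<close>, \<open>\<zeta>\<^sup>i(-1 + \<zeta> - \<zeta>\<^sup>2)\<close> of the arcs from \<open>2i\<close> are chosen so that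
  the three voltages at each vertex add up to \<open>0\<close>: this harmonic choice makes every
  automorphism of the base graph act linearly on them.\<close>

definition nbrs :: "nat \<Rightarrow> (nat \<times> vec) list" where
  "nbrs j = map (\<lambda>(d, f). ((j + d) mod 16, (zeta ^^ (j div 2)) f))
     (if even j then [(1, Vec 1 0 0 0), (15, Vec 0 (-1) 1 0), (5, Vec (-1) 1 (-1) 0)]
      else [(15, Vec (-1) 0 0 0), (1, Vec 0 0 1 (-1)), (11, Vec 1 0 (-1) 1)])"

fun red :: "int \<Rightarrow> vec \<Rightarrow> vec" where
  "red n (Vec p q r s) = Vec (p mod n) (q mod n) (r mod n) (s mod n)"

text \<open>Integer vectors with reduced coordinates represent the group (\<int>/n)^4;
  \<open>red\<close> picks the representative of a class.\<close>

definition box :: "int \<Rightarrow> vec set" where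
  "box n = (\<lambda>(p, q, r, s). Vec p q r s) ` ({0..<n} \<times> {0..<n} \<times> {0..<n} \<times> {0..<n})"

lemma Vec_in_box_iff: "Vec p q r s \<in> box n \<longleftrightarrow> {p, q, r, s} \<subseteq> {0..<n}"
  by (auto simp: box_def image_iff)

text \<open>The derived graph of the voltage assignment: each fibre is a copy of the covering group,
  and an arc of voltage \<open>f\<close> lifts to arcs that add \<open>f\<close>.\<close>

definition mk_cover :: "int \<Rightarrow> (nat \<times> vec) pair_pre_digraph" where
  "mk_cover n = \<lparr>pverts = {..<16} \<times> box n,
     parcs = {((j, x), (k, y)). j < 16 \<and> x \<in> box n \<and> (\<exists>f. (k, f) \<in> set (nbrs j) \<and> y = red n (x + f))}\<rparr>"

lemma pverts_mk_cover [simp]: "pverts (mk_cover n) = {..<16} \<times> box n"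
  by (simp add: mk_cover_def)

lemma arc_mk_cover_iff:
  "((j, x), (k, y)) \<in> parcs (mk_cover n) \<longleftrightarrow>
     j < 16 \<and> x \<in> box n \<and> (\<exists>f. (k, f) \<in> set (nbrs j) \<and> y = red n (x + f))"
  by (simp add: mk_cover_def)

text \<open>Opposite arcs carry opposite voltages, which makes the cover undirected. Quantifying
  over \<open>set [0..<16]\<close> turns this into a finite evaluation.\<close>

lemma nbrs_symmetric_all:
  "\<forall>j\<in>set [0..<16]. \<forall>(k, f)\<in>set (nbrs j). k < 16 \<and> k \<noteq> j \<and> (j, - f) \<in> set (nbrs k)"
  by code_simp

lemma
  assumes "j < 16" "(k, f) \<in> set (nbrs j)"
  shows nbrs_less: "k < 16" and nbrs_neq: "k \<noteq> j" and nbrs_sym: "(j, - f) \<in> set (nbrs k)"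
  using nbrs_symmetric_all assms by auto

lemma distinct_nbrs_all: "\<forall>j\<in>set [0..<16]. distinct (map fst (nbrs j))"
  by code_simp

lemma distinct_nbrs:
  assumes "j < 16"
  shows "distinct (map fst (nbrs j))"
  using distinct_nbrs_all assms by simp

lemma nbrs_unique:
  assumes "j < 16" "(k, f) \<in> set (nbrs j)" "(k, g) \<in> set (nbrs j)"
  shows "f = g"
  using distinct_nbrs[OF assms(1)] assms(2,3) by (rule eq_key_imp_eq_value)

lemma length_nbrs: "length (nbrs j) = 3"
  by (simp add: nbrs_def)

lemma red_red_add_left [simp]: "red n (red n x + y) = red n (x + y)"
  by (cases x; cases y) (simp add: mod_simps)

lemma red_red_add_right [simp]: "red n (x + red n y) = red n (x + y)"
  by (cases x; cases y) (simp add: mod_simps)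

lemma red_eq: "x \<in> box n \<Longrightarrow> red n x = x"
  by (cases x) (auto simp: Vec_in_box_iff)

lemma red_zero [simp]: "red n 0 = 0"
  by (simp add: zero_vec_def)

lemma finite_box: "finite (box n)"
  by (simp add: box_def)

lemma card_box: "card (box n) = nat n ^ 4"
  unfolding box_def
  by (subst card_image) (auto simp: inj_on_def card_cartesian_product numeral_eq_Suc)

section \<open>The cover as a simple cubic graph\<close>

locale mk_modulus =
  fixes n :: int
  assumes n_pos: "0 < n"
begin

abbreviation "G \<equiv> mk_cover n"

lemma red_in_box: "red n x \<in> box n"
  using n_pos by (cases x) (simp add: Vec_in_box_iff)

lemma parcs_subset: "parcs G \<subseteq> pverts G \<times> pverts G"
  using nbrs_less red_in_box by (auto simp: arc_mk_cover_iff)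

lemma finite_pverts: "finite (pverts G)"
  by (simp add: finite_box)

lemma arc_sym:
  assumes "(u, v) \<in> parcs G"
  shows "(v, u) \<in> parcs G"
proof -
  obtain j x k f where u: "u = (j, x)" and v: "v = (k, red n (x + f))"
    and f: "(k, f) \<in> set (nbrs j)" and j: "j < 16" and x: "x \<in> box n"
    using assms by (cases u; cases v) (auto simp: arc_mk_cover_iff)
  have "red n (red n (x + f) + - f) = x"
    using x by (subst red_red_add_left) (simp add: red_eq)
  with nbrs_sym[OF j f] nbrs_less[OF j f] show ?thesis
    unfolding u v arc_mk_cover_iff by (metis red_in_box)
qed

lemma arc_neq:
  assumes "(u, v) \<in> parcs G"
  shows "u \<noteq> v"
  using assms by (cases u; cases v) (auto simp: arc_mk_cover_iff dest: nbrs_neq[rotated])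

lemma pair_graph: "pair_graph G"
proof
  show "finite (pverts G)" by (rule finite_pverts)
  then show "finite (parcs G)"
    using parcs_subset by (meson finite_SigmaI finite_subset)
  show "symmetric (with_proj G)"
    by (auto simp: symmetric_def intro!: symI arc_sym)
next
  fix a assume "a \<in> parcs G"
  then show "fst a \<in> pverts G" "snd a \<in> pverts G" "fst a \<noteq> snd a"
    using parcs_subset arc_neq[of "fst a" "snd a"] by (auto simp del: pverts_mk_cover)
qed

lemma valent: "valent 3 G"
  unfolding valent_def
proof
  fix v assume "v \<in> pverts G"
  then obtain j x where v: "v = (j, x)" and j: "j < 16" and x: "x \<in> box n"
    by (cases v) simp
  have "out_arcs (with_proj G) v = (\<lambda>(k, f). (v, (k, red n (x + f)))) ` set (nbrs j)"
    using j x by (auto simp: v arc_mk_cover_iff)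
  moreover have "inj_on (\<lambda>(k, f). (v, (k, red n (x + f)))) (set (nbrs j))"
    using nbrs_unique[OF j] by (auto simp: inj_on_def)
  moreover have "card (set (nbrs j)) = 3"
    using distinct_nbrs[OF j] by (simp add: distinct_card distinct_map length_nbrs)
  ultimately show "out_degree (with_proj G) v = 3"
    by (simp add: out_degree_def card_image)
qed

end

subsection \<open>Connectedness\<close>

text \<open>A walk is coded by positions in the neighbour lists; its total voltage is the
  displacement between the ends of a lift.\<close>

fun voltage_walk :: "nat \<Rightarrow> nat list \<Rightarrow> nat \<times> vec" where
  "voltage_walk j [] = (j, 0)"
| "voltage_walk j (i # is) =
     (let (k, f) = nbrs j ! i; (l, g) = voltage_walk k is in (l, f + g))"

text \<open>Position 0 at an even vertex and position 1 at an odd one both lead to the successor on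
  the 16-cycle, so the walk runs along the cycle up to 16, that is, to 0.\<close>

lemma voltage_walk_to_0:
  "\<forall>j\<in>set [0..<16]. fst (voltage_walk j (map (\<lambda>i. i mod 2) [j..<16])) = 0"
  by code_simp

text \<open>Closed walks for six times each basis vector; they generate the whole covering group
  once 6 is invertible modulo \<open>n\<close>.\<close>

lemma voltage_walk_closed:
  "voltage_walk 0 [0, 1, 0, 1, 2, 0, 1, 0, 1, 2] = (0, Vec 6 0 0 0)"
  "voltage_walk 0 [0, 1, 0, 1, 0, 1, 2, 0, 2, 1] = (0, Vec 0 6 0 0)"
  "voltage_walk 0 [1, 0, 1, 0, 1, 0, 1, 2, 0, 2] = (0, Vec 0 0 6 0)"
  "voltage_walk 0 [1, 0, 1, 0, 1, 2, 0, 2, 1, 0] = (0, Vec 0 0 0 6)"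
  by code_simp+

context mk_modulus
begin

interpretation pair_graph G by (rule pair_graph)

lemma reachable_voltage_walk:
  assumes "j < 16" "\<forall>i\<in>set is. i < 3"
  shows "(j, red n x) \<rightarrow>\<^sup>*\<^bsub>with_proj G\<^esub>
    (fst (voltage_walk j is), red n (x + snd (voltage_walk j is)))"
  using assms
proof (induction "is" arbitrary: j x)
  case Nil
  then show ?case
    using red_in_box by auto
next
  case (Cons i "is")
  obtain k f where f: "nbrs j ! i = (k, f)" by (cases "nbrs j ! i")
  then have kf: "(k, f) \<in> set (nbrs j)"
    using Cons.prems length_nbrs by (metis list.set_intros(1) nth_mem)
  have "((j, red n x), (k, red n (x + f))) \<in> parcs G"
    using kf Cons.prems red_in_box by (auto simp: arc_mk_cover_iff intro!: exI[of _ f])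
  then have "(j, red n x) \<rightarrow>\<^sup>*\<^bsub>with_proj G\<^esub> (k, red n (x + f))"
    by (intro reachable_adjI) simp
  also have "(k, red n (x + f)) \<rightarrow>\<^sup>*\<^bsub>with_proj G\<^esub>
      (fst (voltage_walk k is), red n (x + f + snd (voltage_walk k is)))"
    using Cons.prems nbrs_less[OF _ kf] by (intro Cons.IH) auto
  finally show ?case
    by (simp add: f case_prod_beta add.assoc)
qed

text \<open>Displacements that walks realise from every point of the fibre over 0. They are closed
  under addition, so generators suffice.\<close>

definition loop :: "vec \<Rightarrow> bool" where
  "loop c \<longleftrightarrow> (\<forall>x. (0, red n x) \<rightarrow>\<^sup>*\<^bsub>with_proj G\<^esub> (0, red n (x + c)))"

lemma loop_add:
  assumes "loop c" "loop d"
  shows "loop (c + d)"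
  unfolding loop_def
proof
  fix x
  have "(0, red n x) \<rightarrow>\<^sup>*\<^bsub>with_proj G\<^esub> (0, red n (x + c))"
    using assms(1) unfolding loop_def by blast
  also have "(0, red n (x + c)) \<rightarrow>\<^sup>*\<^bsub>with_proj G\<^esub> (0, red n (x + c + d))"
    using assms(2) unfolding loop_def by blast
  finally show "(0, red n x) \<rightarrow>\<^sup>*\<^bsub>with_proj G\<^esub> (0, red n (x + (c + d)))"
    by (simp add: add.assoc)
qed

lemma loop_mult:
  assumes "loop (Vec a b c d)"
  shows "loop (Vec (int k * a) (int k * b) (int k * c) (int k * d))"
proof (induction k)
  case 0
  show ?case
    using red_in_box by (auto simp: loop_def simp flip: zero_vec_def)
next
  case (Suc k)
  from loop_add[OF assms Suc] show ?case
    by (simp add: algebra_simps)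
qed

lemma loop_six: "loop (Vec (6 * int a) (6 * int b) (6 * int c) (6 * int d))"
proof -
  have closed: "loop v" if "voltage_walk 0 is = (0, v)" "\<forall>i\<in>set is. i < 3" for v "is"
    using reachable_voltage_walk[of 0 "is"] that by (simp add: loop_def)
  have "loop (Vec 6 0 0 0)" "loop (Vec 0 6 0 0)" "loop (Vec 0 0 6 0)" "loop (Vec 0 0 0 6)"
    by (rule closed[OF voltage_walk_closed(1)] closed[OF voltage_walk_closed(2)]
      closed[OF voltage_walk_closed(3)] closed[OF voltage_walk_closed(4)]; simp)+
  from loop_add[OF loop_add[OF loop_add[OF loop_mult[OF this(1), of a] loop_mult[OF this(2), of b]]
      loop_mult[OF this(3), of c]] loop_mult[OF this(4), of d]]
  show ?thesis by (simp add: mult.commute)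
qed

text \<open>Here \<open>t\<close> is an inverse of 6, so the multiples \<open>t * p\<close> of the
  closed walks reach every point over 0, and each vertex has a walk into that fibre.\<close>

lemma connected_if_coprime_6:
  assumes six: "(6 * int t) mod n = 1 mod n"
  shows "Digraph_Component.connected (with_proj G)"
proof -
  let ?o = "(0, 0) :: nat \<times> vec"
  have o: "?o \<in> pverts G"
    using n_pos by (simp add: Vec_in_box_iff zero_vec_def)
  have mod_six: "(6 * int (t * nat p)) mod n = p" if "p \<in> {0..<n}" for p
  proof -
    have "(6 * int t * p) mod n = (1 * p) mod n"
      using six by (metis mod_mult_left_eq)
    with that show ?thesis by (simp add: mult.assoc)
  qed
  have from0: "?o \<rightarrow>\<^sup>*\<^bsub>with_proj G\<^esub> (0, x)" if "x \<in> box n" for x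
  proof -
    obtain p q r s where x: "x = Vec p q r s" by (cases x)
    have "(0, red n 0) \<rightarrow>\<^sup>*\<^bsub>with_proj G\<^esub> (0, red n (0 +
        (Vec (6 * int (t * nat p)) (6 * int (t * nat q)) (6 * int (t * nat r)) (6 * int (t * nat s)))))"
      using loop_six[of "t * nat p" "t * nat q" "t * nat r" "t * nat s"]
      unfolding loop_def by blast
    moreover have "red n (0 +
        (Vec (6 * int (t * nat p)) (6 * int (t * nat q)) (6 * int (t * nat r)) (6 * int (t * nat s)))) = x"
      using mod_six that unfolding x Vec_in_box_iff zero_vec_def by (simp del: of_nat_mult)
    ultimately show ?thesis by (simp only: red_zero)
  qed
  have to0: "v \<rightarrow>\<^sup>*\<^bsub>with_proj G\<^esub> ?o" if vG: "v \<in> pverts G" for v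
  proof -
    obtain j x where v: "v = (j, x)" "j < 16" "x \<in> box n"
      using vG by (cases v) simp
    let ?w = "map (\<lambda>i. i mod 2) [j..<16]"
    have "fst (voltage_walk j ?w) = 0"
      using voltage_walk_to_0 v(2) by (simp del: upt_rec_numeral)
    moreover have "(j, red n x) \<rightarrow>\<^sup>*\<^bsub>with_proj G\<^esub>
        (fst (voltage_walk j ?w), red n (x + snd (voltage_walk j ?w)))"
      using v(2) by (intro reachable_voltage_walk) auto
    ultimately have "v \<rightarrow>\<^sup>*\<^bsub>with_proj G\<^esub> (0, red n (x + snd (voltage_walk j ?w)))"
      using v by (simp add: red_eq)
    also have "(0, red n (x + snd (voltage_walk j ?w))) \<rightarrow>\<^sup>*\<^bsub>with_proj G\<^esub> ?o"
      using from0[OF red_in_box] by (rule symmetric_reachable[OF pair_sym_arcs])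
    finally show ?thesis .
  qed
  have "strongly_connected (with_proj G)"
  proof (rule strongly_connectedI)
    show "verts (with_proj G) \<noteq> {}" using o unfolding with_proj_simps by blast
  next
    fix u v assume "u \<in> verts (with_proj G)" "v \<in> verts (with_proj G)"
    then have "u \<rightarrow>\<^sup>*\<^bsub>with_proj G\<^esub> ?o" "v \<rightarrow>\<^sup>*\<^bsub>with_proj G\<^esub> ?o"
      using to0 by simp_all
    then show "u \<rightarrow>\<^sup>*\<^bsub>with_proj G\<^esub> v"
      by (meson reachable_trans symmetric_reachable[OF pair_sym_arcs])
  qed
  \<comment> \<open>Connectedness is strong connectedness of the symmetric closure, which is the
    graph itself.\<close>
  moreover have "mk_symmetric (with_proj G) = G"
    using arc_sym by (intro pair_pre_digraph.equality) (auto simp: mk_symmetric_def)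
  ultimately show ?thesis
    by (simp add: Digraph_Component.connected_def)
qed

end

subsection \<open>Transitivity on 2-arcs\<close>

text \<open>Generators 0 and 1 generate a dihedral group that is regular on the vertices of the base
  graph; generators 2 and 3 generate the stabiliser of the vertex 0, which induces the full
  symmetric group on its neighbours.\<close>

definition gen_perm :: "nat \<Rightarrow> nat \<Rightarrow> nat" where
  "gen_perm g j =
     [(j + 2) mod 16,
      (17 - j) mod 16,
      [0, 1, 12, 11, 10, 15, 14, 13, 8, 9, 4, 3, 2, 7, 6, 5] ! j,
      [0, 15, 10, 11, 6, 5, 4, 9, 8, 7, 2, 3, 14, 13, 12, 1] ! j] ! g"

text \<open>The linear maps on voltages that accompany the permutations: for generator 0
  multiplication by \<zeta>, for generator 1 the negative of complex conjugation.\<close>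

fun gen_mat :: "nat \<Rightarrow> vec \<Rightarrow> vec" where
  "gen_mat g (Vec p q r s) =
     [Vec (- s) p q r,
      Vec (- p) s r q,
      Vec (p + q - s) (r + s) (- r) (q + r),
      Vec (r + s) (- p - q - r) (p - s) s] ! g"

text \<open>The lifting criterion for a base automorphism: the voltage of an image arc is the linear
  image of the voltage.\<close>

lemma gen_nbrs_all:
  "\<forall>g\<in>set [0..<4]. \<forall>j\<in>set [0..<16].
     gen_perm g j < 16 \<and>
     (\<forall>(k, f)\<in>set (nbrs j). (gen_perm g k, gen_mat g f) \<in> set (nbrs (gen_perm g j)))"
  by code_simp

lemma
  assumes "g < 4" "j < 16"
  shows gen_perm_less: "gen_perm g j < 16"
    and gen_nbrs: "(k, f) \<in> set (nbrs j) \<Longrightarrow> (gen_perm g k, gen_mat g f) \<in> set (nbrs (gen_perm g j))"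
  using bspec[OF bspec[OF gen_nbrs_all, of g], of j] assms by auto

lemma distinct_gen_perm_all: "\<forall>g\<in>set [0..<4]. distinct (map (gen_perm g) [0..<16])"
  by code_simp

lemma inj_on_gen_perm:
  assumes "g < 4"
  shows "inj_on (gen_perm g) {..<16}"
proof -
  have "distinct (map (gen_perm g) [0..<16])"
    using distinct_gen_perm_all assms by simp
  then show ?thesis
    by (simp add: distinct_map lessThan_atLeast0 del: upt_rec_numeral)
qed

lemma less_4_cases:
  assumes "(g :: nat) < 4"
  obtains "g = 0" | "g = 1" | "g = 2" | "g = 3"
  using assms by linarith

lemma gen_mat_add: "g < 4 \<Longrightarrow> gen_mat g (x + y) = gen_mat g x + gen_mat g y"
  by (elim less_4_cases; cases x; cases y) (simp_all add: numeral_eq_Suc)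

text \<open>These are the shapes of the three-term entries of \<open>gen_mat\<close>.\<close>

lemma mod_add_diff_left: "(a mod n + b mod n - c) mod n = (a + b - c) mod n"
  and mod_minus_diff_left: "(- (a mod n) - b mod n - c) mod n = (- a - b - c) mod n"
  for a b c n :: int
proof -
  have "(a mod n + b mod n - c) mod n = ((a mod n + b mod n) mod n - c) mod n"
    by (simp only: mod_diff_left_eq)
  also have "\<dots> = ((a + b) mod n - c) mod n"
    by (simp only: mod_add_eq)
  finally show "(a mod n + b mod n - c) mod n = (a + b - c) mod n"
    by (simp only: mod_diff_left_eq)
  have "(- (a mod n) - b mod n) mod n = ((- (a mod n)) mod n - b mod n) mod n"
    by (simp only: mod_diff_left_eq)
  also have "\<dots> = (- a - b) mod n"
    by (simp only: mod_minus_eq mod_diff_eq)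
  finally have "((- (a mod n) - b mod n) mod n - c) mod n = ((- a - b) mod n - c) mod n"
    by simp
  then show "(- (a mod n) - b mod n - c) mod n = (- a - b - c) mod n"
    by (simp only: mod_diff_left_eq)
qed

lemma red_gen_mat_red: "g < 4 \<Longrightarrow> red n (gen_mat g (red n x)) = red n (gen_mat g x)"
  by (elim less_4_cases; cases x) (simp_all add: numeral_eq_Suc mod_simps mod_add_diff_left mod_minus_diff_left)

text \<open>One exponent serves all four generators; the seventh power is then an inverse that also
  acts modulo \<open>n\<close>.\<close>

lemma gen_mat_order: "g < 4 \<Longrightarrow> (gen_mat g ^^ 8) x = x"
  by (elim less_4_cases; cases x) (simp_all add: numeral_eq_Suc)

lemma red_funpow_gen_mat_red:
  assumes "g < 4"
  shows "red n ((gen_mat g ^^ k) (red n x)) = red n ((gen_mat g ^^ k) x)"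
proof (induction k)
  case 0
  show ?case by (cases x) simp
next
  case (Suc k)
  then show ?case
    using red_gen_mat_red[OF assms, of n] by (metis comp_apply funpow.simps(2))
qed

lemma red_gen_mat_inj:
  assumes "g < 4" "red n (gen_mat g x) = red n (gen_mat g y)"
  shows "red n x = red n y"
proof -
  have "red n x = red n ((gen_mat g ^^ 7) (gen_mat g x))" for x
    using gen_mat_order[OF assms(1), of x] by (simp add: numeral_eq_Suc)
  then show ?thesis
    using red_funpow_gen_mat_red[OF assms(1)] assms(2) by metis
qed

text \<open>Generator 1 takes 0 to 1 and generator 0 adds 2, so the word with parameters
  \<open>i\<close> and \<open>k\<close> takes 0 to \<open>2 * i + k\<close>.\<close>

lemma gen_words_vertices_all:
  "\<forall>j\<in>set [0..<16]. \<exists>w\<in>set [replicate i 0 @ replicate k 1. i \<leftarrow> [0..<8], k \<leftarrow> [0..<2]].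
     foldr gen_perm w 0 = j \<and> (\<forall>g\<in>set w. g < 4)"
  by code_simp

text \<open>On the neighbours 1, 15, 5 of 0, generator 2 swaps 5 with 15 and generator 3 swaps 1
  with 15; the six words give all permutations of them.\<close>

lemma gen_words_neighbours_all:
  "\<forall>i\<in>set (map fst (nbrs 0)). \<forall>k\<in>set (map fst (nbrs 0)). i \<noteq> k \<longrightarrow>
     (\<exists>w\<in>set [[], [2], [3], [2, 3], [3, 2], [2, 3, 2]].
        map (foldr gen_perm w) [1, 0, 5] = [i, 0, k] \<and> (\<forall>g\<in>set w. g < 4))"
  by code_simp

lemma gen_word_vertex:
  assumes "j < 16"
  obtains w where "foldr gen_perm w 0 = j" "\<forall>g\<in>set w. g < 4"
proof -
  from assms have "j \<in> set [0..<16]" by simp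
  from bspec[OF gen_words_vertices_all this] show thesis
    by (elim bexE conjE) (rule that)
qed

lemma gen_word_neighbours:
  assumes "i \<in> set (map fst (nbrs 0))" "k \<in> set (map fst (nbrs 0))" "i \<noteq> k"
  obtains w where "foldr gen_perm w 1 = i" "foldr gen_perm w 0 = 0" "foldr gen_perm w 5 = k"
    "\<forall>g\<in>set w. g < 4"
proof -
  from bspec[OF bspec[OF gen_words_neighbours_all assms(1)] assms(2), THEN mp, OF assms(3)]
  obtain w where "map (foldr gen_perm w) [1, 0, 5] = [i, 0, k]" "\<forall>g\<in>set w. g < 4"
    by (elim bexE conjE)
  then show thesis by (intro that) simp_all
qed

section \<open>Lifting automorphisms to the cover\<close>

context mk_modulus
begin

text \<open>The deck transformations: translating a fibre coordinate commutes with adding a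
  voltage.\<close>

lemma translation_automorphism:
  "(\<lambda>(j, x). if (j, x) \<in> pverts G then (j, red n (x + c)) else (j, x)) \<in> automorphisms G"
proof (rule automorphismsI[OF finite_pverts parcs_subset])
  let ?f = "\<lambda>(j, x). if (j, x) \<in> pverts G then (j, red n (x + c)) else (j, x)"
  show "?f ` pverts G \<subseteq> pverts G"
    using red_in_box by auto
  show "inj_on ?f (pverts G)"
  proof (rule inj_onI)
    fix u v assume uv: "u \<in> pverts G" "v \<in> pverts G" "?f u = ?f v"
    then obtain j x y where u: "u = (j, x)" and v: "v = (j, y)" and xy: "x \<in> box n" "y \<in> box n"
      and eq: "red n (x + c) = red n (y + c)"
      by auto
    have "red n (red n (x + c) + - c) = red n (red n (y + c) + - c)"
      unfolding eq ..
    then have "red n x = red n y"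
      unfolding red_red_add_left by simp
    with xy show "u = v"
      unfolding u v by (simp add: red_eq)
  qed
  show "?f v = v" if "v \<notin> pverts G" for v
    using that by (cases v) auto
  show "(?f u, ?f v) \<in> parcs G" if uv: "(u, v) \<in> parcs G" for u v
  proof -
    obtain j x k f where u: "u = (j, x)" and v: "v = (k, red n (x + f))"
      and f: "(k, f) \<in> set (nbrs j)" and j: "j < 16" and x: "x \<in> box n"
      using uv by (cases u; cases v) (auto simp: arc_mk_cover_iff)
    have "red n (red n (x + f) + c) = red n (red n (x + c) + f)"
      by (simp add: ac_simps)
    then show ?thesis
      using u v f j x nbrs_less[OF j f] red_in_box by (auto simp: arc_mk_cover_iff)
  qed
qed

lemma gen_automorphism:
  assumes g: "g < 4"
  shows "(\<lambda>(j, x). if (j, x) \<in> pverts G then (gen_perm g j, red n (gen_mat g x)) else (j, x))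
    \<in> automorphisms G"
proof (rule automorphismsI[OF finite_pverts parcs_subset])
  let ?f = "\<lambda>(j, x). if (j, x) \<in> pverts G then (gen_perm g j, red n (gen_mat g x)) else (j, x)"
  show "?f ` pverts G \<subseteq> pverts G"
    using red_in_box gen_perm_less[OF g] by auto
  show "inj_on ?f (pverts G)"
  proof (rule inj_onI)
    fix u v assume uv: "u \<in> pverts G" "v \<in> pverts G" "?f u = ?f v"
    then obtain j x k y where u: "u = (j, x)" and v: "v = (k, y)" and xy: "x \<in> box n" "y \<in> box n"
      and jk: "j < 16" "k < 16" "gen_perm g j = gen_perm g k"
      and eq: "red n (gen_mat g x) = red n (gen_mat g y)"
      by auto
    have "j = k"
      using inj_on_gen_perm[OF g] jk by (auto simp: inj_on_def)
    moreover have "x = y"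
      using red_gen_mat_inj[OF g eq] xy by (simp add: red_eq)
    ultimately show "u = v"
      unfolding u v by simp
  qed
  show "?f v = v" if "v \<notin> pverts G" for v
    using that by (cases v) auto
  show "(?f u, ?f v) \<in> parcs G" if uv: "(u, v) \<in> parcs G" for u v
  proof -
    obtain j x k f where u: "u = (j, x)" and v: "v = (k, red n (x + f))"
      and f: "(k, f) \<in> set (nbrs j)" and j: "j < 16" and x: "x \<in> box n"
      using uv by (cases u; cases v) (auto simp: arc_mk_cover_iff)
    \<comment> \<open>By linearity the image of the far end differs from that of \<open>x\<close> by
      \<open>gen_mat g f\<close>, the voltage of the image arc.\<close>
    have "red n (gen_mat g (red n (x + f))) = red n (red n (gen_mat g x) + gen_mat g f)"
      by (simp add: red_gen_mat_red[OF g] gen_mat_add[OF g])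
    moreover have "(gen_perm g k, gen_mat g f) \<in> set (nbrs (gen_perm g j))"
      by (rule gen_nbrs[OF g j f])
    ultimately show ?thesis
      using u v f j x nbrs_less[OF j f] red_in_box gen_perm_less[OF g j]
      by (auto simp: arc_mk_cover_iff)
  qed
qed

text \<open>Only the action on the base is recorded; translations adjust the fibre coordinates
  later.\<close>

lemma word_automorphism:
  assumes "\<forall>g\<in>set w. g < 4"
  obtains f where "f \<in> automorphisms G" "\<And>v. v \<in> pverts G \<Longrightarrow> fst (f v) = foldr gen_perm w (fst v)"
  using assms
proof (induction w arbitrary: thesis)
  case Nil
  then show ?case using id_automorphism by force
next
  case (Cons g w)
  obtain f where f: "f \<in> automorphisms G"
    "\<And>v. v \<in> pverts G \<Longrightarrow> fst (f v) = foldr gen_perm w (fst v)"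
    using Cons.IH Cons.prems(2) by auto
  let ?g = "\<lambda>(j, x). if (j, x) \<in> pverts G then (gen_perm g j, red n (gen_mat g x)) else (j, x)"
  have "?g \<circ> f \<in> automorphisms G"
    using gen_automorphism f(1) Cons.prems(2) by (intro automorphisms_comp) auto
  moreover have "fst ((?g \<circ> f) v) = foldr gen_perm (g # w) (fst v)" if v: "v \<in> pverts G" for v
  proof -
    have "f v \<in> pverts G"
      using f(1) v by (simp add: automorphisms_def permutes_in_image del: pverts_mk_cover)
    with f(2)[OF v] show ?thesis
      by (cases "f v") (simp add: case_prod_beta)
  qed
  ultimately show ?case by (rule Cons.prems(1))
qed

lemma two_arc_verts:
  assumes "(u, v, w) \<in> two_arcs G"
  shows "u \<in> pverts G" "v \<in> pverts G" "w \<in> pverts G"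
  using assms parcs_subset unfolding two_arcs_def by blast+

text \<open>The covering map is injective on neighbourhoods, so the two ends stay distinct in the
  base.\<close>

lemma two_arc_fibres:
  assumes "(u, v, w) \<in> two_arcs G"
  shows "fst u \<in> set (map fst (nbrs (fst v)))" "fst w \<in> set (map fst (nbrs (fst v)))"
    "fst u \<noteq> fst w"
proof -
  obtain i x j y k z where uvw: "u = (i, x)" "v = (j, y)" "w = (k, z)"
    by (cases u; cases v; cases w)
  have "(v, u) \<in> parcs G" "(v, w) \<in> parcs G" "u \<noteq> w"
    using assms arc_sym by (auto simp: two_arcs_def)
  then obtain f g where "j < 16" "(i, f) \<in> set (nbrs j)" "(k, g) \<in> set (nbrs j)"
    "x = red n (y + f)" "z = red n (y + g)" "(i, x) \<noteq> (k, z)"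
    unfolding uvw arc_mk_cover_iff by blast
  then show "fst u \<in> set (map fst (nbrs (fst v)))" "fst w \<in> set (map fst (nbrs (fst v)))"
    "fst u \<noteq> fst w"
    using nbrs_unique[of j i f g] by (force simp: uvw)+
qed

definition equivalent :: "(nat \<times> vec) \<times> (nat \<times> vec) \<times> (nat \<times> vec) \<Rightarrow>
    (nat \<times> vec) \<times> (nat \<times> vec) \<times> (nat \<times> vec) \<Rightarrow> bool" where
  "equivalent = (\<lambda>(u, v, w) t. \<exists>f\<in>automorphisms G. (f u, f v, f w) = t)"

lemma equivalent_trans:
  assumes "equivalent a b" "equivalent b c"
  shows "equivalent a c"
proof -
  obtain u v w where a: "a = (u, v, w)" by (cases a)
  obtain f where f: "f \<in> automorphisms G" "b = (f u, f v, f w)"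
    using assms(1) by (auto simp: equivalent_def a)
  obtain g where "g \<in> automorphisms G" "(g (f u), g (f v), g (f w)) = c"
    using assms(2) by (auto simp: equivalent_def f(2))
  with f(1) show ?thesis
    unfolding equivalent_def a by (auto intro!: bexI[of _ "g \<circ> f"] automorphisms_comp)
qed

lemma equivalent_sym:
  assumes "equivalent a b"
  shows "equivalent b a"
proof -
  obtain u v w where a: "a = (u, v, w)" by (cases a)
  obtain f where f: "f \<in> automorphisms G" "b = (f u, f v, f w)"
    using assms by (auto simp: equivalent_def a)
  have "inj f"
    using f(1) by (auto simp: automorphisms_def permutes_inj)
  then have "(inv f (f u), inv f (f v), inv f (f w)) = (u, v, w)"
    by simp
  then show ?thesis
    using automorphisms_inv[OF f(1)] unfolding equivalent_def a f(2) prod.case by blast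
qed

text \<open>A 2-arc is determined by its middle vertex and its projection to the base graph.\<close>

lemma equivalent_if_same_fibres:
  assumes t: "(u, v, w) \<in> two_arcs G" "(u', v', w') \<in> two_arcs G"
    and fibres: "fst u = fst u'" "fst v = fst v'" "fst w = fst w'"
  shows "equivalent (u, v, w) (u', v', w')"
proof -
  obtain i x j y k z where uvw: "u = (i, x)" "v = (j, y)" "w = (k, z)"
    by (cases u; cases v; cases w)
  obtain x' y' z' where uvw': "u' = (i, x')" "v' = (j, y')" "w' = (k, z')"
    using fibres by (cases u'; cases v'; cases w') (auto simp: uvw)
  have arcs: "(v, u) \<in> parcs G" "(v, w) \<in> parcs G" "(v', u') \<in> parcs G" "(v', w') \<in> parcs G"
    using t arc_sym by (auto simp: two_arcs_def)
  obtain f g where fg: "j < 16" "y \<in> box n" "(i, f) \<in> set (nbrs j)" "(k, g) \<in> set (nbrs j)"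
      "x = red n (y + f)" "z = red n (y + g)"
    using arcs(1,2) unfolding uvw arc_mk_cover_iff by blast
  obtain f' g' where fg': "y' \<in> box n" "(i, f') \<in> set (nbrs j)" "(k, g') \<in> set (nbrs j)"
      "x' = red n (y' + f')" "z' = red n (y' + g')"
    using arcs(3,4) unfolding uvw' arc_mk_cover_iff by blast
  have eq: "f' = f" "g' = g"
    using nbrs_unique fg fg' by blast+
  let ?h = "\<lambda>(j, x). if (j, x) \<in> pverts G then (j, red n (x + (y' - y))) else (j, x)"
  have "?h u = u'" "?h v = v'" "?h w = w'"
    using two_arc_verts[OF t(1)] fg fg' unfolding uvw uvw' eq
    by (simp_all add: red_eq add.commute)
  then show ?thesis
    using translation_automorphism[of "y' - y"] unfolding equivalent_def by force
qed

lemma equivalent_image: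
  assumes "f \<in> automorphisms G"
  shows "equivalent (u, v, w) (f u, f v, f w)"
  using assms by (auto simp: equivalent_def)

text \<open>Every 2-arc is compared with one lift of (1, 0, 5) centred at the origin: its middle
  vertex is moved to the origin, then the stabiliser of 0 matches the projection to the
  base.\<close>

lemma two_arc_transitive: "two_arc_transitive G"
proof -
  let ?a = "((1, red n (Vec 1 0 0 0)), (0, 0), (5, red n (Vec (-1) 1 (-1) 0))) ::
    (nat \<times> vec) \<times> (nat \<times> vec) \<times> (nat \<times> vec)"
  have "((0, 0), (1, red n (Vec 1 0 0 0))) \<in> parcs G" "((0, 0), (5, red n (Vec (-1) 1 (-1) 0))) \<in> parcs G"
    using n_pos
    by (auto simp: arc_mk_cover_iff nbrs_def Vec_in_box_iff zero_vec_def)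
  then have a: "?a \<in> two_arcs G"
    using arc_sym by (auto simp: two_arcs_def)
  have centred: "equivalent ?a (u, v, w)" if t: "(u, v, w) \<in> two_arcs G" and v: "fst v = 0" for u v w
  proof -
    obtain word where word: "foldr gen_perm word 1 = fst u" "foldr gen_perm word 0 = 0"
      "foldr gen_perm word 5 = fst w" "\<forall>g\<in>set word. g < 4"
      using two_arc_fibres[OF t] unfolding v by (rule gen_word_neighbours)
    obtain f where f: "f \<in> automorphisms G"
      "\<And>v. v \<in> pverts G \<Longrightarrow> fst (f v) = foldr gen_perm word (fst v)"
      using word_automorphism[OF word(4)] by blast
    let ?b = "(f (1, red n (Vec 1 0 0 0)), f (0, 0), f (5, red n (Vec (-1) 1 (-1) 0)))"
    have "equivalent ?a ?b"
      using f(1) by (rule equivalent_image)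
    moreover have "equivalent ?b (u, v, w)"
    proof (rule equivalent_if_same_fibres)
      show "?b \<in> two_arcs G"
        using f(1) parcs_subset a by (rule two_arcs_automorphism)
    qed (use t v word f(2)[OF two_arc_verts(1)[OF a]] f(2)[OF two_arc_verts(2)[OF a]]
      f(2)[OF two_arc_verts(3)[OF a]] in simp_all)
    ultimately show ?thesis by (rule equivalent_trans)
  qed
  have all: "equivalent ?a (u, v, w)" if t: "(u, v, w) \<in> two_arcs G" for u v w
  proof -
    have "fst v < 16"
      using two_arc_verts[OF t] by auto
    then obtain word where word: "foldr gen_perm word 0 = fst v" "\<forall>g\<in>set word. g < 4"
      by (rule gen_word_vertex)
    obtain f where f: "f \<in> automorphisms G"
      "\<And>v. v \<in> pverts G \<Longrightarrow> fst (f v) = foldr gen_perm word (fst v)"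
      using word_automorphism[OF word(2)] by blast
    have "f (0, 0) \<in> pverts G"
      using two_arc_verts(2)[OF two_arcs_automorphism[OF f(1) parcs_subset a]] .
    moreover have "fst (f (0, 0)) = fst v"
      using f(2)[OF two_arc_verts(2)[OF a]] word(1) by simp
    \<comment> \<open>Translation by the difference of the fibre coordinates moves
      \<open>f (0, 0)\<close> to \<open>v\<close>.\<close>
    ultimately obtain h where h: "h \<in> automorphisms G" "h (f (0, 0)) = v"
      using translation_automorphism[of "snd v - snd (f (0, 0))"] two_arc_verts(2)[OF t]
      by (cases "f (0, 0)"; cases v) (force simp: red_eq)
    let ?k = "inv (h \<circ> f)"
    have hf: "h \<circ> f \<in> automorphisms G"
      using h(1) f(1) by (rule automorphisms_comp)
    have "inj (h \<circ> f)"
      using hf by (auto simp: automorphisms_def permutes_inj)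
    then have "?k ((h \<circ> f) (0, 0)) = (0, 0)"
      by (rule inv_f_f)
    then have "?k v = (0, 0)"
      by (simp only: comp_apply h(2))
    moreover have k: "?k \<in> automorphisms G"
      using hf by (rule automorphisms_inv)
    ultimately have "equivalent ?a (?k u, ?k v, ?k w)"
      using two_arcs_automorphism[OF k parcs_subset t] by (intro centred) auto
    then show ?thesis
      using equivalent_image[OF k] by (blast intro: equivalent_trans equivalent_sym)
  qed
  show ?thesis
    unfolding two_arc_transitive_def
  proof (clarify del: bexI)
    fix u v w u' v' w' assume "(u, v, w) \<in> two_arcs G" "(u', v', w') \<in> two_arcs G"
    then have "equivalent (u, v, w) (u', v', w')"
      by (blast intro: all equivalent_trans equivalent_sym)
    then show "\<exists>f\<in>automorphisms G. (f u, f v, f w) = (u', v', w')"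
      by (auto simp: equivalent_def)
  qed
qed

end

subsection \<open>A sparse eigenvector\<close>

text \<open>The support of the eigenvector in the \<open>\<int>\<^sup>4\<close>-cover, invariant under \<open>(j, x) \<mapsto> (j + 8, -x)\<close>. It was
  found by solving the eigenvector equations in a ball around the origin.\<close>

definition half_pattern :: "(nat \<times> vec) list" where
  "half_pattern =
   [(0, Vec (-2) (-2) 0 (-2)), (0, Vec (-2) 1 0 1), (0, Vec (-2) 4 0 (-2)), (0, Vec 1 (-2) 3 (-2)),
    (0, Vec 1 1 (-3) 1), (0, Vec 4 (-2) 0 4), (1, Vec (-4) 4 (-3) (-2)), (1, Vec (-1) (-2) 0 (-2)),
    (1, Vec (-1) 1 0 1), (1, Vec 2 (-5) 3 1), (2, Vec (-4) 4 (-2) (-3)), (2, Vec (-1) 1 1 0),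
    (2, Vec 2 1 (-2) 0), (2, Vec 5 (-2) 1 3), (3, Vec (-4) 2 (-2) 0), (3, Vec (-1) (-1) 1 (-3)),
    (3, Vec (-1) 2 1 0), (3, Vec 2 (-4) 4 0), (3, Vec 2 (-1) (-2) 3), (3, Vec 2 2 (-2) 0),
    (4, Vec (-3) 2 (-2) 1), (4, Vec (-3) 5 (-2) (-2)), (4, Vec 0 (-4) 1 1), (4, Vec 0 (-1) 1 (-2)),
    (5, Vec 0 (-4) 2 1), (5, Vec 0 (-1) 2 (-2)), (5, Vec 3 (-1) (-1) 4), (5, Vec 3 2 (-1) 1),
    (6, Vec (-4) 0 (-1) (-2)), (6, Vec (-1) 0 2 (-2)), (6, Vec (-1) 3 (-4) 1), (6, Vec 2 3 (-1) 1),
    (7, Vec (-4) 0 (-1) (-1)), (7, Vec (-1) 0 2 (-1)), (7, Vec 2 (-3) (-1) 2), (7, Vec 5 (-3) 2 2)]"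

definition pattern :: "(nat \<times> vec) list" where
  "pattern = half_pattern @ map (\<lambda>(j, x). (j + 8, - x)) half_pattern"

definition closed_nbrs :: "nat \<times> vec \<Rightarrow> (nat \<times> vec) list" where
  "closed_nbrs = (\<lambda>(j, x). (j, x) # map (\<lambda>(k, f). (k, x + f)) (nbrs j))"

text \<open>Addition over the field of order 2: one copy survives of each element that occurs an odd
  number of times.\<close>

fun odd_part :: "'a list \<Rightarrow> 'a list" where
  "odd_part [] = []"
| "odd_part (z # zs) = (let ys = odd_part zs in if z \<in> set ys then remove1 z ys else z # ys)"

text \<open>This is the eigenvector equation in the infinite cover: in characteristic 2 it says that
  each vertex lies in an even number of closed neighbourhoods of support vertices.\<close>

lemma odd_part_closed_nbrs_pattern: "odd_part (concat (map closed_nbrs pattern)) = []"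
  by code_simp

lemma count_list_map_remove1:
  assumes "z \<in> set ys"
  shows "count_list (map h ys) v = count_list (map h (remove1 z ys)) v + of_bool (h z = v)"
  using assms by (induction ys) auto

text \<open>Equal entries cancel in pairs, also after applying \<open>h\<close>. With
  \<open>h\<close> the reduction modulo \<open>n\<close>, one evaluation in the infinite cover
  settles all quotients.\<close>

lemma even_count_list_map_odd_part:
  "even (count_list (map h (odd_part zs)) v) \<longleftrightarrow> even (count_list (map h zs) v)"
proof (induction zs)
  case (Cons z zs)
  then show ?case
    using count_list_map_remove1[of z "odd_part zs" h v] by (auto simp: Let_def)
qed simp

lemma count_list_distinct: "distinct zs \<Longrightarrow> count_list zs z = of_bool (z \<in> set zs)"
  by (induction zs) auto

lemma of_nat_bit_even: "even k \<Longrightarrow> of_nat k = (0 :: bit)"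
  by (elim evenE) simp

lemma bit_add_eq_0D: "a + b = 0 \<Longrightarrow> b = (a :: bit)"
  by (cases a; cases b) simp_all

lemma pattern_less_16: "\<forall>z\<in>set pattern. fst z < 16"
  by code_simp

lemma length_pattern: "length pattern = 72"
  by (simp add: pattern_def half_pattern_def)

lemma sum_count_list_map:
  assumes "finite U"
  shows "(\<Sum>u\<in>U. of_nat (count_list (map h zs) u)) =
    (of_nat (length (filter (\<lambda>z. h z \<in> U) zs)) :: 'k::semiring_1)"
proof (induction zs)
  case (Cons z zs)
  have "(\<Sum>u\<in>U. of_nat (count_list (map h (z # zs)) u)) =
      (\<Sum>u\<in>U. (if h z = u then 1 else 0) + of_nat (count_list (map h zs) u) :: 'k)"
    by (intro sum.cong) auto
  also have "\<dots> = of_nat (length (filter (\<lambda>z. h z \<in> U) (z # zs)))"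
    using assms by (simp add: sum.distrib Cons.IH)
  finally show ?case .
qed simp

section \<open>The eigenvector in the finite covers\<close>

context mk_modulus
begin

abbreviation proj :: "nat \<times> vec \<Rightarrow> nat \<times> vec" where
  "proj \<equiv> \<lambda>(j, x). (j, red n x)"

text \<open>The push-forward of the pattern to the finite cover. Vertices that become equal are
  added modulo 2, so 72 bounds the support from above.\<close>

definition mode :: "nat \<times> vec \<Rightarrow> bit" where
  "mode v = of_nat (count_list (map proj pattern) v)"

lemma mode_eq_0: "v \<notin> set (map proj pattern) \<Longrightarrow> mode v = 0"
  by (simp add: mode_def)

text \<open>Reduction modulo \<open>n\<close> maps closed neighbourhoods bijectively onto closed
  neighbourhoods.\<close>

lemma count_list_closed_nbrs:
  assumes "fst z < 16"
  shows "count_list (map proj (closed_nbrs z)) v =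
    of_bool (proj z = v) + of_bool ((proj z, v) \<in> parcs G)"
proof -
  obtain j x k y where z: "z = (j, x)" and v: "v = (k, y)" by (cases z; cases v)
  have j: "j < 16" using assms z by simp
  let ?zs = "map (\<lambda>(k, f). (k, red n (x + f))) (nbrs j)"
  have "map fst ?zs = map fst (nbrs j)"
    by (simp add: case_prod_beta comp_def)
  then have "distinct ?zs"
    using distinct_nbrs[OF j] by (metis distinct_map)
  then have "count_list ?zs v = of_bool (v \<in> set ?zs)"
    by (rule count_list_distinct)
  moreover have "v \<in> set ?zs \<longleftrightarrow> (proj z, v) \<in> parcs G"
    using j red_in_box by (auto simp: z v arc_mk_cover_iff)
  moreover have "map proj (closed_nbrs z) = proj z # ?zs"
    by (simp add: closed_nbrs_def z case_prod_beta comp_def)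
  ultimately show ?thesis by simp
qed

lemma count_list_concat_closed_nbrs:
  assumes "\<forall>z\<in>set zs. fst z < 16"
  shows "count_list (map proj (concat (map closed_nbrs zs))) v =
    count_list (map proj zs) v + length (filter (\<lambda>z. (proj z, v) \<in> parcs G) zs)"
  using assms
proof (induction zs)
  case (Cons z zs)
  then show ?case
    using count_list_closed_nbrs[of z v] by (simp add: map_concat)
qed simp

lemma mode_eigenspace: "mode \<in> eigenspace G 1"
proof -
  have "(\<Sum>u | (u, v) \<in> parcs G. mode u) = mode v" for v
  proof -
    have fin: "finite {u. (u, v) \<in> parcs G}"
      by (rule finite_subset[OF _ finite_pverts]) (use parcs_subset in blast)
    have "even (count_list (map proj (concat (map closed_nbrs pattern))) v)"
      using even_count_list_map_odd_part[of proj "concat (map closed_nbrs pattern)" v]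
      by (simp add: odd_part_closed_nbrs_pattern)
    then have "even (count_list (map proj pattern) v + length (filter (\<lambda>z. (proj z, v) \<in> parcs G) pattern))"
      by (simp only: count_list_concat_closed_nbrs[OF pattern_less_16])
    then have "of_nat (count_list (map proj pattern) v + length (filter (\<lambda>z. (proj z, v) \<in> parcs G) pattern)) = (0 :: bit)"
      by (rule of_nat_bit_even)
    then have "mode v + of_nat (length (filter (\<lambda>z. (proj z, v) \<in> parcs G) pattern)) = 0"
      by (simp only: mode_def of_nat_add)
    \<comment> \<open>Double counting: both sides count, modulo 2, the pattern entries that reduce
      to a neighbour of \<open>v\<close>.\<close>
    moreover have "(\<Sum>u | (u, v) \<in> parcs G. mode u) = of_nat (length (filter (\<lambda>z. (proj z, v) \<in> parcs G) pattern))"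
      unfolding mode_def sum_count_list_map[OF fin] by simp
    ultimately show ?thesis
      by (simp only: bit_add_eq_0D)
  qed
  moreover have "mode v = 0" if "v \<notin> pverts G" for v
  proof -
    have "v \<notin> set (map proj pattern)"
      using that pattern_less_16 red_in_box by (cases v) force
    then show ?thesis
      by (rule mode_eq_0)
  qed
  ultimately show ?thesis
    unfolding eigenspace_one_F2[OF pair_graph] by blast
qed

lemma card_support_mode: "card {v. mode v \<noteq> 0} \<le> 72"
proof -
  have "{v. mode v \<noteq> 0} \<subseteq> set (map proj pattern)"
    using mode_eq_0 by blast
  then have "card {v. mode v \<noteq> 0} \<le> card (set (map proj pattern))"
    by (intro card_mono) auto
  also have "\<dots> \<le> length (map proj pattern)"
    by (rule card_length)
  finally show ?thesis by (simp add: length_pattern)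
qed

lemma mode_nonzero:
  assumes "7 \<le> n"
  shows "mode (proj (4, Vec 0 (-1) 1 (-2))) \<noteq> 0"
proof -
  \<comment> \<open>The pattern has four vertices over 4, with second coordinates 2, 5, -4 and -1.
    The differences from -1 are 3, 6 and -3, so no two of these meet the last one modulo
    \<open>n\<close> at least 7.\<close>
  have neq: "a mod n \<noteq> (- 1) mod n" if "a \<in> {2, 5, -4}" for a
  proof
    assume "a mod n = (- 1) mod n"
    then have "n dvd a + 1"
      by (simp add: mod_eq_dvd_iff)
    with that have "\<bar>n\<bar> \<le> 6"
      using dvd_imp_le_int[of "a + 1" n] by auto
    with assms show False by simp
  qed
  have "count_list (map proj pattern) (proj (4, Vec 0 (-1) 1 (-2))) = 1"
    using neq by (simp add: pattern_def half_pattern_def)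
  then show ?thesis by (simp add: mode_def)
qed

end

section \<open>Assembling the family\<close>

lemma vertex_transitive_if_two_arc_transitive:
  assumes "two_arc_transitive G"
    and "\<And>v. v \<in> pverts G \<Longrightarrow> \<exists>u w. (u, v, w) \<in> two_arcs G"
    and "u \<in> pverts G" "v \<in> pverts G"
  shows "\<exists>f\<in>automorphisms G. f u = v"
proof -
  obtain a b c d where "(a, u, b) \<in> two_arcs G" "(c, v, d) \<in> two_arcs G"
    using assms(2-4) by blast
  then have "\<exists>f\<in>automorphisms G. (f a, f u, f b) = (c, v, d)"
    using assms(1) unfolding two_arc_transitive_def by fast
  then show ?thesis by blast
qed

lemma ex_two_arc_if_valent:
  assumes "pair_graph G" "valent 3 G" "v \<in> pverts G"
  shows "\<exists>u w. (u, v, w) \<in> two_arcs G"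
proof -
  interpret pair_graph G by fact
  have "card (out_arcs (with_proj G) v) = 3"
    using assms(2,3) by (simp add: valent_def out_degree_def)
  then obtain a b where ab: "a \<in> out_arcs (with_proj G) v" "b \<in> out_arcs (with_proj G) v" "a \<noteq> b"
    by (metis card_2_iff' card.empty card_3_iff insertCI)
  then have "(v, snd a) \<in> parcs G" "(v, snd b) \<in> parcs G" "snd a \<noteq> snd b"
    by (cases a; cases b; simp)+
  then have "(snd a, v, snd b) \<in> two_arcs G"
    using arcs_symmetric by (simp add: two_arcs_def)
  then show ?thesis by blast
qed

theorem theorem1p2:
  shows "\<exists>\<Lambda> :: nat \<Rightarrow> nat pair_pre_digraph.
    (\<forall>m n. m \<noteq> n \<longrightarrow> \<not> digraph_iso (with_proj (\<Lambda> m)) (with_proj (\<Lambda> n))) \<and>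
    (\<forall>n. pair_graph (\<Lambda> n) \<and>
         Digraph_Component.connected (with_proj (\<Lambda> n)) \<and>
         valent 3 (\<Lambda> n) \<and>
         two_arc_transitive (\<Lambda> n) \<and>
         real (fun_space.dim (eigenspace (\<Lambda> n) (1 :: bit))) \<ge> real (card (pverts (\<Lambda> n))) / 72)"
proof -
  \<comment> \<open>Coprimality to 6 makes the covers connected; at least 7 keeps the eigenvector from cancelling.\<close>
  let ?n = "\<lambda>m. 6 * int m + 7"
  let ?e = "to_nat :: nat \<times> vec \<Rightarrow> nat"
  let ?L = "\<lambda>m. relabel ?e (mk_cover (?n m))"
  have e: "inj ?e" by simp
  have card: "card (pverts (?L m)) = 16 * (6 * m + 7) ^ 4" for m
  proof -
    have "card (pverts (?L m)) = card (pverts (mk_cover (?n m)))"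
      unfolding pverts_relabel by (intro card_image inj_on_subset[OF e] subset_UNIV)
    also have "\<dots> = 16 * nat (?n m) ^ 4"
      by (simp add: card_cartesian_product card_box)
    also have "nat (?n m) = 6 * m + 7" by simp
    finally show ?thesis .
  qed
  have "\<not> digraph_iso (with_proj (?L m)) (with_proj (?L k))" if "m \<noteq> k" for m k
  proof
    assume "digraph_iso (with_proj (?L m)) (with_proj (?L k))"
    then have "(6 * m + 7) ^ 4 = (6 * k + 7) ^ 4"
      using card_pverts_eq_if_digraph_iso card by fastforce
    then have "6 * m + 7 = 6 * k + 7"
      by (rule power_eq_imp_eq_base) simp_all
    with that show False by simp
  qed
  moreover have "pair_graph (?L m) \<and> Digraph_Component.connected (with_proj (?L m)) \<and>
      valent 3 (?L m) \<and> two_arc_transitive (?L m) \<and>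
      real (fun_space.dim (eigenspace (?L m) (1 :: bit))) \<ge> real (card (pverts (?L m))) / 72" for m
  proof -
    interpret mk_modulus "?n m" by unfold_locales simp
    \<comment> \<open>As \<open>?n m\<close> is 1 modulo 6, the number \<open>5 * ?n m + 1\<close>
      is divisible by 6; the quotient \<open>5 * m + 6\<close> inverts 6.\<close>
    have six: "(6 * int (5 * m + 6)) mod ?n m = 1 mod ?n m"
    proof -
      have "6 * int (5 * m + 6) = 1 + ?n m * 5" by simp
      then show ?thesis by (simp only: mod_mult_self2)
    qed
    have L: "pair_graph (?L m)"
      using e pair_graph by (rule pair_graph_relabel)
    have conn: "Digraph_Component.connected (with_proj (?L m))"
      using e pair_graph connected_if_coprime_6[OF six] by (rule connected_relabel)
    have val: "valent 3 (?L m)"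
      using e pair_graph valent by (rule valent_relabel)
    have trans: "two_arc_transitive (?L m)"
      using e pair_graph two_arc_transitive by (rule two_arc_transitive_relabel)
    obtain y where y: "y \<in> eigenspace (?L m) 1" "\<And>v. y (?e v) = mode v"
        "{v. y v \<noteq> 0} = ?e ` {v. mode v \<noteq> 0}"
      using eigenspace_relabel[OF e pair_graph mode_eigenspace] by metis
    have "card (pverts (?L m)) \<le> 72 * fun_space.dim (eigenspace (?L m) (1 :: bit))"
    proof (rule card_verts_le_mult_dim_eigenspace[OF _ _ y(1)])
      show "finite (pverts (?L m))"
        using finite_pverts by simp
      show "\<exists>f\<in>automorphisms (?L m). f u = v" if "u \<in> pverts (?L m)" "v \<in> pverts (?L m)" for u v
        using trans ex_two_arc_if_valent[OF L val] that by (rule vertex_transitive_if_two_arc_transitive)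
      show "y (?e (proj (4, Vec 0 (-1) 1 (-2)))) \<noteq> 0"
        unfolding y(2) by (rule mode_nonzero) simp
      have "card {v. y v \<noteq> 0} = card {v. mode v \<noteq> 0}"
        unfolding y(3) by (intro card_image inj_on_subset[OF e] subset_UNIV)
      then show "card {v. y v \<noteq> 0} \<le> 72"
        using card_support_mode by simp
    qed
    then have "real (card (pverts (?L m))) \<le> 72 * real (fun_space.dim (eigenspace (?L m) (1 :: bit)))"
      by (metis of_nat_le_iff of_nat_mult of_nat_numeral)
    with L conn val trans show ?thesis by simp
  qed
  ultimately show ?thesis by (intro exI[of _ ?L]) blast
qed

end
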